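(* Let $p_0,r\ge0$, $0\le\Delta\le p\le\tfrac12$ with $p_0+2p+r=1$, assume $\alpha:=1-2(p+r)>0$ and $p\ne\tfrac14$, and let $\{\Lambda_n\}_{n\ge0}$ be the discrete-time qubit dynamics defined in the context (with $\phi_k[X]=\sigma_kX\sigma_k$). Then: (i) $\Lambda_n$ is P-divisible if and only if $2p\Delta\le r\alpha+p\alpha$; (ii) $\Lambda_n$ is CP-divisible if and only if $2p\Delta\le r\alpha$; (iii) $\Lambda_n\otimes\Lambda_n$ is P-divisible if and only if $$2p\Delta\le\alpha(r+p)-\frac{\alpha}{2}\Big(1-\sqrt{1-4p(1-2p)}\Big).$$
   Context: $\sigma_1,\sigma_2,\sigma_3$ are the Pauli matrices, $\sigma_0=\mathbb{1}_2$, and $\phi_k[X]=\sigma_kX\sigma_k$ on $M_2(\mathbb{C})$, $k=0,1,2,3$. The transition matrix (rows and columns indexed by $0,1,2,3$) is $$T=\begin{pmatrix}p_0&p_0&p_0&p_0\\ p&p+\Delta&p-\Delta&p\\ p&p-\Delta&p+\Delta&p\\ r&r&r&r\end{pmatrix},$$ with invariant probability vector $\boldsymbol p=(p_0,p,p,r)$, entries denoted $p_i$ (so $p_1=p_2=p$, $p_3=r$). Put $p_{i_1\cdots i_n}=T_{i_ni_{n-1}}\cdots T_{i_2i_1}p_{i_1}$ and $$\Lambda_n=\sum_{i_1,\dots,i_n=0}^3p_{i_1\cdots i_n}\,\phi_{i_n}\circ\cdots\circ\phi_{i_1}\quad(n\ge1),\qquad\Lambda_0=\mathrm{id}.$$ Under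 the stated assumptions the maps $\Lambda_n$ are invertible as linear maps. The family $\Lambda_n$ is called P-divisible (respectively CP-divisible) if for all integers $n\ge m\ge0$ the intertwiner $\Lambda_{n,m}=\Lambda_n\circ\Lambda_m^{-1}$ is a positive (respectively completely positive) trace-preserving map. Likewise $\Lambda_n\otimes\Lambda_n$ is P-divisible if $\Lambda_{n,m}\otimes\Lambda_{n,m}$ is a positive trace-preserving map on $M_2(\mathbb{C})\otimes M_2(\mathbb{C})$ for all $n\ge m\ge0$. *)

theory Defs
  imports "HOL-Analysis.Analysis"
begin

section \<open>Complex matrices and linear maps between them\<close>

definition cscale :: "complex \<Rightarrow> complex^'n^'m \<Rightarrow> complex^'n^'m" where
  "cscale c A = (\<chi> i j. c * A $ i $ j)"

lemma vector_space_cscale: "vector_space cscale"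
  by unfold_locales (simp_all add: cscale_def vec_eq_iff algebra_simps)

abbreviation clinear_map :: "(complex^'n^'n \<Rightarrow> complex^'m^'m) \<Rightarrow> bool" where
  "clinear_map \<equiv> Vector_Spaces.linear cscale cscale"

text \<open>
  In the order on \<^typ>\<open>complex\<close>, \<open>0 \<le> z\<close> means that \<open>z\<close> is real and nonnegative, so
  that the following condition entails that \<open>A\<close> is Hermitian.
\<close>

definition psd :: "complex^'n^'n \<Rightarrow> bool" where
  "psd A \<longleftrightarrow> (\<forall>v. 0 \<le> (\<Sum>i\<in>UNIV. cnj (v $ i) * (A *v v) $ i))"

definition positive_map :: "(complex^'n^'n \<Rightarrow> complex^'m^'m) \<Rightarrow> bool" where
  "positive_map F \<longleftrightarrow> clinear_map F \<and> (\<forall>X. psd X \<longrightarrow> psd (F X))"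

definition trace_preserving :: "(complex^'n^'n \<Rightarrow> complex^'m^'m) \<Rightarrow> bool" where
  "trace_preserving F \<longleftrightarrow> (\<forall>X. trace (F X) = trace X)"

text \<open>
  For complete positivity the size \<open>k\<close> of the ancilla has to be quantified over. An element of
  \<open>M\<^sub>k(\<complex>) \<otimes> M\<^sub>n(\<complex>) = M\<^sub>k(M\<^sub>n(\<complex>))\<close> is therefore given by its blocks \<open>X i j\<close> with \<open>i, j < k\<close>,
  and \<open>id\<^sub>k \<otimes> F\<close> acts blockwise.
\<close>

definition block_psd :: "nat \<Rightarrow> (nat \<Rightarrow> nat \<Rightarrow> complex^'n^'n) \<Rightarrow> bool" where
  "block_psd k X \<longleftrightarrow>
     (\<forall>v :: nat \<Rightarrow> complex^'n.
        0 \<le> (\<Sum>i<k. \<Sum>j<k. \<Sum>a\<in>UNIV. cnj (v i $ a) * (X i j *v v j) $ a))"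

definition completely_positive_map :: "(complex^'n^'n \<Rightarrow> complex^'m^'m) \<Rightarrow> bool" where
  "completely_positive_map F \<longleftrightarrow>
     clinear_map F \<and> (\<forall>k X. block_psd k X \<longrightarrow> block_psd k (\<lambda>i j. F (X i j)))"


section \<open>Tensor products\<close>

definition kron :: "complex^'n^'n \<Rightarrow> complex^'m^'m \<Rightarrow> complex^('n \<times> 'm)^('n \<times> 'm)" where
  "kron A B = (\<chi> r c. A $ fst r $ fst c * B $ snd r $ snd c)"

definition matrix_unit :: "'n \<Rightarrow> 'n \<Rightarrow> complex^'n^'n" where
  "matrix_unit i j = (\<chi> a b. if a = i \<and> b = j then 1 else 0)"

text \<open>
  \<open>F \<otimes> G\<close> is obtained by expanding \<open>X\<close> in the basis \<open>E\<^sub>i\<^sub>j \<otimes> E\<^sub>k\<^sub>l\<close>;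
  \<open>tensor_map_kron\<close> below is the characteristic property.
\<close>

definition tensor_map ::
  "(complex^'n^'n \<Rightarrow> complex^'n^'n) \<Rightarrow> (complex^'m^'m \<Rightarrow> complex^'m^'m) \<Rightarrow>
     complex^('n \<times> 'm)^('n \<times> 'm) \<Rightarrow> complex^('n \<times> 'm)^('n \<times> 'm)" where
  "tensor_map F G X =
     (\<Sum>i\<in>UNIV. \<Sum>j\<in>UNIV. \<Sum>k\<in>UNIV. \<Sum>l\<in>UNIV.
        cscale (X $ (i, k) $ (j, l)) (kron (F (matrix_unit i j)) (G (matrix_unit k l))))"

lemma clinear_map_expand:
  assumes "clinear_map F"
  shows "F A = (\<Sum>i\<in>UNIV. \<Sum>j\<in>UNIV. cscale (A $ i $ j) (F (matrix_unit i j)))"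
proof -
  interpret F: Vector_Spaces.linear cscale cscale F by (fact assms)
  have "A = (\<Sum>i\<in>UNIV. \<Sum>j\<in>UNIV. cscale (A $ i $ j) (matrix_unit i j))"
  proof (subst vec_eq_iff, subst vec_eq_iff, intro allI)
    fix a b
    have "A $ a $ b = (\<Sum>i\<in>UNIV. if i = a then \<Sum>j\<in>UNIV. if j = b then A $ i $ j else 0 else 0)"
      by simp
    also have "\<dots> = (\<Sum>i\<in>UNIV. \<Sum>j\<in>UNIV. A $ i $ j * (if a = i \<and> b = j then 1 else 0))"
      by (intro sum.cong refl) (auto simp: if_distrib[of "(*) _"] cong: if_cong)
    also have "\<dots> = (\<Sum>i\<in>UNIV. \<Sum>j\<in>UNIV. cscale (A $ i $ j) (matrix_unit i j)) $ a $ b"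
      by (simp add: cscale_def matrix_unit_def)
    finally show "A $ a $ b = \<dots>" .
  qed
  then have "F A = F (\<Sum>i\<in>UNIV. \<Sum>j\<in>UNIV. cscale (A $ i $ j) (matrix_unit i j))"
    by simp
  then show ?thesis
    by (simp add: F.sum F.scale)
qed

lemma tensor_map_kron:
  assumes "clinear_map F" "clinear_map G"
  shows "tensor_map F G (kron A B) = kron (F A) (G B)"
proof (subst vec_eq_iff, subst vec_eq_iff, intro allI)
  fix r c
  have "kron (F A) (G B) $ r $ c =
      (\<Sum>i\<in>UNIV. \<Sum>j\<in>UNIV. A $ i $ j * F (matrix_unit i j) $ fst r $ fst c) *
      (\<Sum>k\<in>UNIV. \<Sum>l\<in>UNIV. B $ k $ l * G (matrix_unit k l) $ snd r $ snd c)"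
    by (subst clinear_map_expand[OF assms(1)], subst clinear_map_expand[OF assms(2)])
      (simp add: kron_def cscale_def)
  also have "\<dots> = (\<Sum>i\<in>UNIV. \<Sum>j\<in>UNIV. \<Sum>k\<in>UNIV. \<Sum>l\<in>UNIV.
      (A $ i $ j * F (matrix_unit i j) $ fst r $ fst c) *
      (B $ k $ l * G (matrix_unit k l) $ snd r $ snd c))"
    unfolding sum_distrib_right unfolding sum_distrib_left ..
  also have "\<dots> = tensor_map F G (kron A B) $ r $ c"
    by (simp add: tensor_map_def kron_def cscale_def mult.assoc mult.left_commute)
  finally show "tensor_map F G (kron A B) $ r $ c = kron (F A) (G B) $ r $ c" ..
qed


section \<open>Divisibility of discrete-time families\<close>

text \<open>
  Only meant for families of bijective maps: \<^const>\<open>inv\<close> is the inverse map only in that case.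
\<close>

definition intertwiner ::
  "(nat \<Rightarrow> complex^'n^'n \<Rightarrow> complex^'n^'n) \<Rightarrow> nat \<Rightarrow> nat \<Rightarrow> complex^'n^'n \<Rightarrow> complex^'n^'n" where
  "intertwiner L n m = L n \<circ> inv (L m)"

definition P_divisible :: "(nat \<Rightarrow> complex^'n^'n \<Rightarrow> complex^'n^'n) \<Rightarrow> bool" where
  "P_divisible L \<longleftrightarrow>
     (\<forall>n m. m \<le> n \<longrightarrow>
        positive_map (intertwiner L n m) \<and> trace_preserving (intertwiner L n m))"

definition CP_divisible :: "(nat \<Rightarrow> complex^'n^'n \<Rightarrow> complex^'n^'n) \<Rightarrow> bool" where
  "CP_divisible L \<longleftrightarrow>
     (\<forall>n m. m \<le> n \<longrightarrow>
        completely_positive_map (intertwiner L n m) \<and> trace_preserving (intertwiner L n m))"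

text \<open>P-divisibility of the family \<open>L\<^sub>n \<otimes> L\<^sub>n\<close>.\<close>

definition tensor_P_divisible :: "(nat \<Rightarrow> complex^'n^'n \<Rightarrow> complex^'n^'n) \<Rightarrow> bool" where
  "tensor_P_divisible L \<longleftrightarrow>
     (\<forall>n m. m \<le> n \<longrightarrow>
        positive_map (tensor_map (intertwiner L n m) (intertwiner L n m)) \<and>
        trace_preserving (tensor_map (intertwiner L n m) (intertwiner L n m)))"


section \<open>The qubit dynamics\<close>

definition pauli :: "nat \<Rightarrow> complex^2^2" where
  "pauli k =
     [mat 1,
      vector [vector [0, 1], vector [1, 0]],
      vector [vector [0, - \<i>], vector [\<i>, 0]],
      vector [vector [1, 0], vector [0, - 1]]] ! k"

definition pauli_map :: "nat \<Rightarrow> complex^2^2 \<Rightarrow> complex^2^2" where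
  "pauli_map k X = pauli k ** X ** pauli k"

definition trans_mat :: "real \<Rightarrow> real \<Rightarrow> real \<Rightarrow> real \<Rightarrow> nat \<Rightarrow> nat \<Rightarrow> real" where
  "trans_mat p0 p \<Delta> r i j =
     [[p0, p0,    p0,    p0],
      [p,  p + \<Delta>, p - \<Delta>, p],
      [p,  p - \<Delta>, p + \<Delta>, p],
      [r,  r,     r,     r]] ! i ! j"

definition inv_prob :: "real \<Rightarrow> real \<Rightarrow> real \<Rightarrow> nat \<Rightarrow> real" where
  "inv_prob p0 p r i = [p0, p, p, r] ! i"

text \<open>
  A path \<open>i\<^sub>1, \<dots>, i\<^sub>n\<close> is a nonempty list \<open>is\<close>; the entry \<open>i\<^sub>k\<close> is \<open>is ! (k - 1)\<close>.
\<close>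

definition path_prob :: "real \<Rightarrow> real \<Rightarrow> real \<Rightarrow> real \<Rightarrow> nat list \<Rightarrow> real" where
  "path_prob p0 p \<Delta> r is =
     (\<Prod>k = 1..<length is. trans_mat p0 p \<Delta> r (is ! k) (is ! (k - 1))) *
     inv_prob p0 p r (is ! 0)"

text \<open>\<open>fold pauli_map is\<close> is the map \<open>\<phi>\<^bsub>i\<^sub>n\<^esub> \<circ> \<dots> \<circ> \<phi>\<^bsub>i\<^sub>1\<^esub>\<close>.\<close>

definition qubit_dynamics ::
  "real \<Rightarrow> real \<Rightarrow> real \<Rightarrow> real \<Rightarrow> nat \<Rightarrow> complex^2^2 \<Rightarrow> complex^2^2" where
  "qubit_dynamics p0 p \<Delta> r n X =
     (if n = 0 then X
      else (\<Sum>is\<in>{is. length is = n \<and> set is \<subseteq> {0..3}}.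
              path_prob p0 p \<Delta> r is *\<^sub>R fold pauli_map is X))"

end

theory Submission
  imports Defs
begin

text \<open>
  The transition matrix is \<open>\<^bold>p 1\<^sup>T + \<Delta> c c\<^sup>T\<close> with \<open>c = (0, 1, -1, 0)\<close>, so \<open>\<Lambda>\<^sub>n\<close> multiplies
  \<open>\<sigma>\<^sub>3\<close> by \<open>(1 - 4p)\<^sup>n\<close> and \<open>\<sigma>\<^sub>1, \<sigma>\<^sub>2\<close> by \<open>A\<^sub>n\<close>, where \<open>A\<^sub>n\<^sub>+\<^sub>2 = \<alpha> A\<^sub>n\<^sub>+\<^sub>1 + 4p\<Delta> A\<^sub>n\<close>. The one-step
  intertwiners scale \<open>\<sigma>\<^sub>1, \<sigma>\<^sub>2\<close> by \<open>x = A\<^sub>n\<^sub>+\<^sub>1 / A\<^sub>n\<close>, which is largest for \<open>n = 1\<close>, where it is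
  \<open>\<alpha> + 4p\<Delta>/\<alpha>\<close>. Hence everything reduces to one Pauli map, with coherences scaled by \<open>x \<ge> 0\<close> and
  populations mixed with weights \<open>a = (1 + z)/2\<close> and \<open>b = (1 - z)/2\<close> for \<open>z = 1 - 4p\<close>. It is positive iff \<open>x \<le> 1\<close>,
  completely positive iff \<open>x \<le> a\<close>, and its tensor square is positive iff \<open>x\<^sup>2 \<le> a\<^sup>2 + b\<^sup>2\<close>.

  For the last claim, the maximally entangled state gives necessity. If \<open>x\<^sup>2 = a\<^sup>2 + b\<^sup>2\<close>, the tensor square is
  \<open>a\<^sup>2\<close> times the identity, plus \<open>b\<^sup>2\<close> times a transposition composed with a bit flip of both qubits, plus a
  remainder that is a sum of maps each acting on at most two basis states, which differ in one qubit, so that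
  partial transposition does no harm there. Smaller \<open>x\<close> are reached by dephasing first.
\<close>

text \<open>Fixes the identity, multiplies sigma_3 by \<open>z\<close> and the other two Pauli
  matrices by \<open>x\<close>.\<close>

definition axial_map :: "real \<Rightarrow> real \<Rightarrow> complex^2^2 \<Rightarrow> complex^2^2" where
  "axial_map x z X =
     vector [vector [of_real ((1 + z) / 2) * X$1$1 + of_real ((1 - z) / 2) * X$2$2, of_real x * X$1$2],
             vector [of_real x * X$2$1, of_real ((1 - z) / 2) * X$1$1 + of_real ((1 + z) / 2) * X$2$2]]"

text \<open>Takes two vectors, since the blocks in \<open>block_psd\<close> pair different
  ones.\<close>

definition sesq :: "complex^'n^'n \<Rightarrow> complex^'n \<Rightarrow> complex^'n \<Rightarrow> complex" where
  "sesq A f g = (\<Sum>i\<in>UNIV. cnj (f $ i) * (A *v g) $ i)"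

lemma psd_iff_sesq: "psd A \<longleftrightarrow> (\<forall>f. 0 \<le> sesq A f f)"
  by (simp add: psd_def sesq_def)

lemma block_psd_iff_sesq:
  "block_psd k X \<longleftrightarrow> (\<forall>v. 0 \<le> (\<Sum>i<k. \<Sum>j<k. sesq (X i j) (v i) (v j)))"
  by (simp add: block_psd_def sesq_def)

lemma sesq_2:
  fixes A :: "complex^2^2"
  shows "sesq A f g = cnj (f$1) * (A$1$1 * g$1 + A$1$2 * g$2)
     + cnj (f$2) * (A$2$1 * g$1 + A$2$2 * g$2)"
  by (simp add: sesq_def matrix_vector_mult_def sum_2)

lemma mult_cnj_nonneg: "0 \<le> z * cnj z"
  by (simp add: complex_mult_cnj less_eq_complex_def)

lemma sum_UNIV_prod: "(\<Sum>i\<in>(UNIV :: ('a::finite \<times> 'b::finite) set). h i) = (\<Sum>i\<in>UNIV. \<Sum>j\<in>UNIV. h (i, j))"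
  by (simp add: sum.cartesian_product flip: UNIV_Times_UNIV)

lemma clinear_mapI:
  assumes "\<And>X Y. F (X + Y) = F X + F Y" "\<And>c X. F (cscale c X) = cscale c (F X)"
  shows "clinear_map F"
  by (simp add: Vector_Spaces.linear_iff vector_space_cscale assms)

lemma clinear_map_comp: "clinear_map F \<Longrightarrow> clinear_map G \<Longrightarrow> clinear_map (F \<circ> G)"
  by (simp add: Vector_Spaces.linear_iff)

lemma positive_map_comp: "positive_map F \<Longrightarrow> positive_map G \<Longrightarrow> positive_map (F \<circ> G)"
  by (simp add: positive_map_def clinear_map_comp)

lemma completely_positive_map_comp:
  "completely_positive_map F \<Longrightarrow> completely_positive_map G \<Longrightarrow> completely_positive_map (F \<circ> G)"
  by (simp add: completely_positive_map_def clinear_map_comp)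

lemma trace_preserving_comp: "trace_preserving F \<Longrightarrow> trace_preserving G \<Longrightarrow> trace_preserving (F \<circ> G)"
  by (simp add: trace_preserving_def)

lemma axial_map_nth [simp]:
  "axial_map x z X $ 1 $ 1 = of_real ((1 + z) / 2) * X$1$1 + of_real ((1 - z) / 2) * X$2$2"
  "axial_map x z X $ 1 $ 2 = of_real x * X$1$2"
  "axial_map x z X $ 2 $ 1 = of_real x * X$2$1"
  "axial_map x z X $ 2 $ 2 = of_real ((1 - z) / 2) * X$1$1 + of_real ((1 + z) / 2) * X$2$2"
  by (simp_all add: axial_map_def)

lemma clinear_axial_map: "clinear_map (axial_map x z)"
  by (rule clinear_mapI) (simp_all add: vec_eq_iff forall_2 cscale_def algebra_simps)

lemma trace_preserving_axial_map: "trace_preserving (axial_map x z)"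
  by (simp add: trace_preserving_def trace_def sum_2 field_simps)

lemma axial_map_one [simp]: "axial_map 1 1 = id"
  by (rule ext) (simp add: vec_eq_iff forall_2)

lemma axial_map_comp: "axial_map x z \<circ> axial_map x' z' = axial_map (x * x') (z * z')"
  by (rule ext) (simp add: vec_eq_iff forall_2 field_simps)

lemma inv_axial_map:
  assumes "x \<noteq> 0" "z \<noteq> 0"
  shows "inv (axial_map x z) = axial_map (1 / x) (1 / z)"
  by (rule inv_unique_comp) (use assms in \<open>simp_all add: axial_map_comp\<close>)

section \<open>Positivity of axially symmetric Pauli maps\<close>

lemma psd_axial_map:
  assumes "psd X" "\<bar>x\<bar> \<le> 1" "\<bar>z\<bar> \<le> 1"
  shows "psd (axial_map x z X)"
  unfolding psd_iff_sesq
proof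
  fix f :: "complex^2"
  define F :: "complex^2 \<Rightarrow> complex" where "F g = sesq X g g" for g
  define c d a b where "c = complex_of_real ((1 + x) / 2)" and "d = complex_of_real ((1 - x) / 2)"
    and "a = complex_of_real ((1 + z) / 2)" and "b = complex_of_real ((1 - z) / 2)"
  have nn: "0 \<le> F g" for g
    using assms(1) by (simp add: F_def psd_iff_sesq)
  have nn': "0 \<le> c" "0 \<le> d" "0 \<le> a" "0 \<le> b"
    using assms(2,3) by (auto simp: c_def d_def a_def b_def less_eq_complex_def)
  \<comment> \<open>\<open>a\<close> and \<open>b\<close> mix the identity with transposition
    followed by a bit flip, which swaps populations and keeps coherences. \<open>c\<close> and
    \<open>d\<close> mix in conjugation by sigma_3, so coherences are scaled by
    \<open>c - d\<close>, which is \<open>x\<close>.\<close>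
  have "sesq (axial_map x z X) f f =
      c * (a * F f + b * F (vector [cnj (f$2), cnj (f$1)]))
      + d * (a * F (vector [f$1, - f$2]) + b * F (vector [cnj (f$2), - cnj (f$1)]))"
    by (simp add: F_def sesq_2 c_def d_def a_def b_def field_simps)
  also have "\<dots> \<ge> 0"
    by (intro add_nonneg_nonneg mult_nonneg_nonneg nn nn')
  finally show "0 \<le> sesq (axial_map x z X) f f" .
qed

lemma positive_axial_map_iff:
  assumes "0 \<le> x" "\<bar>z\<bar> \<le> 1"
  shows "positive_map (axial_map x z) \<longleftrightarrow> x \<le> 1"
proof
  assume pos: "positive_map (axial_map x z)"
  \<comment> \<open>\<open>J\<close> is twice the projector onto (1, 1); the orthogonal vector (1,
    -1) will give \<open>2 - 2 * x\<close>.\<close>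
  define J :: "complex^2^2" where "J = (\<chi> i j. 1)"
  have "sesq J f f = (f$1 + f$2) * cnj (f$1 + f$2)" for f
    by (simp add: J_def sesq_2 algebra_simps)
  then have "psd J"
    by (simp add: psd_iff_sesq mult_cnj_nonneg del: complex_cnj_add)
  with pos have "psd (axial_map x z J)"
    by (simp add: positive_map_def)
  then have "0 \<le> sesq (axial_map x z J) (vector [1, -1]) (vector [1, -1])"
    unfolding psd_iff_sesq by blast
  then show "x \<le> 1"
    by (simp add: J_def sesq_2 less_eq_complex_def field_simps)
next
  assume "x \<le> 1"
  with assms show "positive_map (axial_map x z)"
    by (simp add: positive_map_def clinear_axial_map psd_axial_map)
qed

lemma completely_positive_axial_map_iff:
  assumes "0 \<le> x" "\<bar>z\<bar> \<le> 1"
  shows "completely_positive_map (axial_map x z) \<longleftrightarrow> x \<le> (1 + z) / 2"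
proof
  assume cp: "completely_positive_map (axial_map x z)"
  \<comment> \<open>Blocks of the unnormalised maximally entangled state, so the image is the Choi
    matrix; the test vector below gives \<open>1 + z - 2 * x\<close>.\<close>
  define E :: "nat \<Rightarrow> nat \<Rightarrow> complex^2^2"
    where "E i j = matrix_unit (if i = 0 then 1 else 2) (if j = 0 then 1 else 2)" for i j
  have "(\<Sum>i<2. \<Sum>j<2. sesq (E i j) (v i) (v j))
      = (v 0 $ 1 + v 1 $ 2) * cnj (v 0 $ 1 + v 1 $ 2)" for v
    by (simp add: E_def sesq_2 matrix_unit_def numeral_2_eq_2 algebra_simps)
  then have "block_psd 2 E"
    by (simp add: block_psd_iff_sesq mult_cnj_nonneg del: complex_cnj_add)
  with cp have "block_psd 2 (\<lambda>i j. axial_map x z (E i j))"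
    by (simp add: completely_positive_map_def)
  then have "0 \<le> (\<Sum>i<2. \<Sum>j<2. sesq (axial_map x z (E i j))
      (if i = 0 then vector [1, 0] else vector [0, -1])
      (if j = 0 then vector [1, 0] else vector [0, -1]))"
    unfolding block_psd_iff_sesq by (rule spec)
  then show "x \<le> (1 + z) / 2"
    by (simp add: E_def sesq_2 matrix_unit_def numeral_2_eq_2 less_eq_complex_def field_simps)
next
  assume x: "x \<le> (1 + z) / 2"
  define c d b where "c = complex_of_real (((1 + z) / 2 + x) / 2)"
    and "d = complex_of_real (((1 + z) / 2 - x) / 2)" and "b = complex_of_real ((1 - z) / 2)"
  have nn': "0 \<le> c" "0 \<le> d" "0 \<le> b"
    using assms x by (auto simp: c_def d_def b_def less_eq_complex_def)
  \<comment> \<open>A Kraus decomposition: identity and sigma_3, then the two jumps between basis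
    states. Each term applies one linear map to both vectors, so it survives an ancilla.\<close>
  have eq: "sesq (axial_map x z X) f g = c * sesq X f g
      + d * sesq X (vector [f$1, - f$2]) (vector [g$1, - g$2])
      + b * sesq X (vector [0, f$1]) (vector [0, g$1])
      + b * sesq X (vector [f$2, 0]) (vector [g$2, 0])" for X f g
    by (simp add: sesq_2 c_def d_def b_def field_simps)
  have "block_psd k (\<lambda>i j. axial_map x z (X i j))" if "block_psd k X" for k X
    unfolding block_psd_iff_sesq
  proof
    fix v :: "nat \<Rightarrow> complex^2"
    define S :: "(complex^2 \<Rightarrow> complex^2) \<Rightarrow> complex"
      where "S K = (\<Sum>i<k. \<Sum>j<k. sesq (X i j) (K (v i)) (K (v j)))" for K
    have nn: "0 \<le> S K" for K
      using that[unfolded block_psd_iff_sesq, rule_format, of "\<lambda>i. K (v i)"] by (simp add: S_def)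
    have "(\<Sum>i<k. \<Sum>j<k. sesq (axial_map x z (X i j)) (v i) (v j))
        = c * S (\<lambda>f. f) + d * S (\<lambda>f. vector [f$1, - f$2])
          + b * S (\<lambda>f. vector [0, f$1]) + b * S (\<lambda>f. vector [f$2, 0])"
      by (simp add: eq S_def sum.distrib sum_distrib_left)
    also have "\<dots> \<ge> 0"
      by (intro add_nonneg_nonneg mult_nonneg_nonneg nn nn')
    finally show "0 \<le> (\<Sum>i<k. \<Sum>j<k. sesq (axial_map x z (X i j)) (v i) (v j))" .
  qed
  then show "completely_positive_map (axial_map x z)"
    by (simp add: completely_positive_map_def clinear_axial_map)
qed

section \<open>Positivity of the tensor square\<close>

lemma clinear_tensor_map: "clinear_map (tensor_map F G)"
proof (rule clinear_mapI)
  show "tensor_map F G (X + Y) = tensor_map F G X + tensor_map F G Y" for X Y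
    by (simp add: tensor_map_def cscale_def vec_eq_iff algebra_simps sum.distrib)
  show "tensor_map F G (cscale c X) = cscale c (tensor_map F G X)" for c X
    by (simp add: tensor_map_def cscale_def vec_eq_iff sum_distrib_left mult.assoc)
qed

text \<open>Serves both to split off a dephasing and to compose one-step intertwiners.\<close>

lemma tensor_map_comp:
  assumes "clinear_map F" "clinear_map F'" "clinear_map G" "clinear_map G'"
  shows "tensor_map (F \<circ> F') (G \<circ> G') = tensor_map F G \<circ> tensor_map F' G'"
proof
  fix X
  interpret T: Vector_Spaces.linear cscale cscale "tensor_map F G"
    by (rule clinear_tensor_map)
  show "tensor_map (F \<circ> F') (G \<circ> G') X = (tensor_map F G \<circ> tensor_map F' G') X"
    by (simp add: tensor_map_def[of F'] tensor_map_def[of "F \<circ> F'"] T.sum T.scale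
        tensor_map_kron assms)
qed


definition vec4 :: "complex \<Rightarrow> complex \<Rightarrow> complex \<Rightarrow> complex \<Rightarrow> complex^(2 \<times> 2)" where
  "vec4 a b c d = (\<chi> i. if i = (1, 1) then a else if i = (1, 2) then b else if i = (2, 1) then c else d)"

lemma sesq_pair:
  fixes A :: "complex^(2\<times>2)^(2\<times>2)"
  shows "sesq A f g = (\<Sum>a\<in>UNIV. \<Sum>b\<in>UNIV. cnj (f $ (a, b)) *
     (A$(a,b)$(1,1) * g$(1,1) + A$(a,b)$(1,2) * g$(1,2) + A$(a,b)$(2,1) * g$(2,1) + A$(a,b)$(2,2) * g$(2,2)))"
  by (simp add: sesq_def matrix_vector_mult_def sum_UNIV_prod sum_2 algebra_simps)

lemma tensor_map_axial_nth:
  fixes x z :: real and X :: "complex^(2\<times>2)^(2\<times>2)"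
  defines "a \<equiv> complex_of_real ((1 + z) / 2)" and "b \<equiv> complex_of_real ((1 - z) / 2)" and "y \<equiv> complex_of_real x"
    and "T \<equiv> tensor_map (axial_map x z) (axial_map x z) X"
  shows
    "T $(1,1)$(1,1) = a*a * X$(1,1)$(1,1) + a*b * X$(1,2)$(1,2) + b*a * X$(2,1)$(2,1) + b*b * X$(2,2)$(2,2)"
    "T $(1,2)$(1,2) = a*b * X$(1,1)$(1,1) + a*a * X$(1,2)$(1,2) + b*b * X$(2,1)$(2,1) + a*b * X$(2,2)$(2,2)"
    "T $(2,1)$(2,1) = a*b * X$(1,1)$(1,1) + b*b * X$(1,2)$(1,2) + a*a * X$(2,1)$(2,1) + a*b * X$(2,2)$(2,2)"
    "T $(2,2)$(2,2) = b*b * X$(1,1)$(1,1) + a*b * X$(1,2)$(1,2) + b*a * X$(2,1)$(2,1) + a*a * X$(2,2)$(2,2)"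
    "T $(1,1)$(1,2) = a*y * X$(1,1)$(1,2) + b*y * X$(2,1)$(2,2)"
    "T $(1,2)$(1,1) = a*y * X$(1,2)$(1,1) + b*y * X$(2,2)$(2,1)"
    "T $(2,1)$(2,2) = b*y * X$(1,1)$(1,2) + a*y * X$(2,1)$(2,2)"
    "T $(2,2)$(2,1) = b*y * X$(1,2)$(1,1) + a*y * X$(2,2)$(2,1)"
    "T $(1,1)$(2,1) = a*y * X$(1,1)$(2,1) + b*y * X$(1,2)$(2,2)"
    "T $(2,1)$(1,1) = a*y * X$(2,1)$(1,1) + b*y * X$(2,2)$(1,2)"
    "T $(1,2)$(2,2) = b*y * X$(1,1)$(2,1) + a*y * X$(1,2)$(2,2)"
    "T $(2,2)$(1,2) = b*y * X$(2,1)$(1,1) + a*y * X$(2,2)$(1,2)"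
    "T $(1,1)$(2,2) = y*y * X$(1,1)$(2,2)"
    "T $(2,2)$(1,1) = y*y * X$(2,2)$(1,1)"
    "T $(1,2)$(2,1) = y*y * X$(1,2)$(2,1)"
    "T $(2,1)$(1,2) = y*y * X$(2,1)$(1,2)"
  unfolding T_def
  by (simp_all add: tensor_map_def sum_2 cscale_def kron_def matrix_unit_def
      a_def b_def y_def field_simps)

lemma trace_preserving_tensor_axial_map:
  "trace_preserving (tensor_map (axial_map x z) (axial_map x z))"
proof -
  have "trace (tensor_map (axial_map x z) (axial_map x z) X) = trace X" for X
    unfolding trace_def sum_UNIV_prod sum_2 tensor_map_axial_nth
    by (simp add: field_simps)
  then show ?thesis
    by (simp add: trace_preserving_def)
qed

text \<open>
  On the right, \<open>b * b\<close> belongs to the bit-flipped transposition of both qubits; the coefficients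
  \<open>a * (y - a)\<close> and \<open>b * (y - b)\<close> belong to the single-qubit coherences left over, and they use up
  the populations \<open>a * b\<close> except for \<open>a * b - a * (y - a) - b * (y - b) = (y - a) * (y - b)\<close>.
\<close>

lemma sesq_tensor_axial_map:
  fixes x z :: real and X :: "complex^(2\<times>2)^(2\<times>2)"
  defines "a \<equiv> complex_of_real ((1 + z) / 2)" and "b \<equiv> complex_of_real ((1 - z) / 2)" and "y \<equiv> complex_of_real x"
    and "F \<equiv> \<lambda>g. sesq X g g"
  assumes x2: "y * y = a * a + b * b"
  shows "sesq (tensor_map (axial_map x z) (axial_map x z) X) f f =
     a * a * F f + b * b * F (vec4 (cnj (f$(2,2))) (cnj (f$(2,1))) (cnj (f$(1,2))) (cnj (f$(1,1))))
   + a * (y - a) *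
     (F (vec4 (cnj (f$(1,2))) (cnj (f$(1,1))) 0 0) + F (vec4 (cnj (f$(2,1))) 0 (cnj (f$(1,1))) 0)
      + F (vec4 0 (cnj (f$(2,2))) 0 (cnj (f$(1,2)))) + F (vec4 0 0 (cnj (f$(2,2))) (cnj (f$(2,1)))))
   + b * (y - b) *
     (F (vec4 (f$(2,1)) (f$(2,2)) 0 0) + F (vec4 (f$(1,2)) 0 (f$(2,2)) 0)
      + F (vec4 0 (f$(1,1)) 0 (f$(2,1))) + F (vec4 0 0 (f$(1,1)) (f$(1,2))))
   + (y - a) * (y - b) *
     ((f$(1,2) * cnj (f$(1,2)) + f$(2,1) * cnj (f$(2,1))) * (F (vec4 1 0 0 0) + F (vec4 0 0 0 1))
      + (f$(1,1) * cnj (f$(1,1)) + f$(2,2) * cnj (f$(2,2))) * (F (vec4 0 1 0 0) + F (vec4 0 0 1 0)))"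
  \<comment> \<open>Coherences between states differing in both qubits come only from the first two
    terms, with coefficient \<open>a * a + b * b\<close>; \<open>x2\<close> matches it with
    \<open>y * y\<close>.\<close>
  using x2 unfolding F_def sesq_pair sum_2 tensor_map_axial_nth
  unfolding a_def[symmetric] b_def[symmetric] y_def[symmetric]
  by (simp add: vec4_def) algebra

text \<open>At this boundary value \<open>x\<close> dominates both mixing weights, so all
  coefficients of the decomposition are nonnegative.\<close>

lemma psd_tensor_axial_map_circle:
  fixes x z :: real
  assumes "psd X" "\<bar>z\<bar> \<le> 1" "0 \<le> x" and x2: "x\<^sup>2 = (1 + z\<^sup>2) / 2"
  shows "psd (tensor_map (axial_map x z) (axial_map x z) X)"
  unfolding psd_iff_sesq
proof
  fix f :: "complex^(2\<times>2)"
  define a b where "a = (1 + z) / 2" and "b = (1 - z) / 2"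
  have ab: "0 \<le> a" "0 \<le> b"
    using assms(2) by (auto simp: a_def b_def)
  have "a\<^sup>2 + b\<^sup>2 = (1 + z\<^sup>2) / 2"
    by (simp add: a_def b_def power2_eq_square field_simps)
  then have eq: "x\<^sup>2 = a\<^sup>2 + b\<^sup>2"
    by (simp add: x2)
  then have "a \<le> x" "b \<le> x"
    using \<open>0 \<le> x\<close> by (simp_all add: power2_le_imp_le[of a x] power2_le_imp_le[of b x])
  have ab': "0 \<le> complex_of_real a" "0 \<le> complex_of_real b"
    using ab by (simp_all add: less_eq_complex_def)
  have le: "0 \<le> complex_of_real x - of_real a" "0 \<le> complex_of_real x - of_real b"
    using \<open>a \<le> x\<close> \<open>b \<le> x\<close> by (simp_all add: less_eq_complex_def)
  have eq': "complex_of_real x * of_real x = of_real a * of_real a + of_real b * of_real b"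
    using eq by (simp add: power2_eq_square flip: of_real_mult of_real_add)
  have nn: "0 \<le> sesq X g g" for g
    using assms(1) by (simp add: psd_iff_sesq)
  show "0 \<le> sesq (tensor_map (axial_map x z) (axial_map x z) X) f f"
    unfolding sesq_tensor_axial_map[OF eq'[unfolded a_def b_def], folded a_def b_def]
    by (intro add_nonneg_nonneg mult_nonneg_nonneg nn le ab' mult_cnj_nonneg)
qed

text \<open>Each qubit independently undergoes conjugation by sigma_3 with probability
  \<open>(1 - x) / 2\<close>.\<close>

lemma psd_tensor_dephasing:
  assumes "psd X" "\<bar>x\<bar> \<le> 1"
  shows "psd (tensor_map (axial_map x 1) (axial_map x 1) X)"
  unfolding psd_iff_sesq
proof
  fix f :: "complex^(2\<times>2)"
  define F where "F g = sesq X g g" for g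
  define c d where "c = complex_of_real ((1 + x) / 2)" and "d = complex_of_real ((1 - x) / 2)"
  have nn: "0 \<le> F g" for g
    using assms(1) by (simp add: F_def psd_iff_sesq)
  have nn': "0 \<le> c" "0 \<le> d"
    using assms(2) by (auto simp: c_def d_def less_eq_complex_def)
  have "sesq (tensor_map (axial_map x 1) (axial_map x 1) X) f f =
      c * c * F f
      + c * d * (F (vec4 (f$(1,1)) (- f$(1,2)) (f$(2,1)) (- f$(2,2)))
               + F (vec4 (f$(1,1)) (f$(1,2)) (- f$(2,1)) (- f$(2,2))))
      + d * d * F (vec4 (f$(1,1)) (- f$(1,2)) (- f$(2,1)) (f$(2,2)))"
    unfolding F_def sesq_pair sum_2 tensor_map_axial_nth
    by (simp add: vec4_def c_def d_def field_simps)
  also have "\<dots> \<ge> 0"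
    by (intro add_nonneg_nonneg mult_nonneg_nonneg nn nn')
  finally show "0 \<le> sesq (tensor_map (axial_map x 1) (axial_map x 1) X) f f" .
qed

lemma positive_tensor_axial_map_iff:
  assumes "0 \<le> x" "\<bar>z\<bar> \<le> 1"
  shows "positive_map (tensor_map (axial_map x z) (axial_map x z)) \<longleftrightarrow> x \<le> sqrt ((1 + z\<^sup>2) / 2)"
proof
  assume pos: "positive_map (tensor_map (axial_map x z) (axial_map x z))"
  \<comment> \<open>The unnormalised maximally entangled state; the test vector (1, 0, 0, -1) will
    give \<open>1 + z^2 - 2 * x^2\<close>.\<close>
  define B :: "complex^(2\<times>2)^(2\<times>2)"
    where "B = (\<chi> r c. if fst r = snd r \<and> fst c = snd c then 1 else 0)"
  have "sesq B f f = (f$(1,1) + f$(2,2)) * cnj (f$(1,1) + f$(2,2))" for f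
    by (simp add: B_def sesq_pair sum_2 algebra_simps)
  then have "psd B"
    by (simp add: psd_iff_sesq mult_cnj_nonneg del: complex_cnj_add)
  with pos have "psd (tensor_map (axial_map x z) (axial_map x z) B)"
    by (simp add: positive_map_def)
  then have "0 \<le> sesq (tensor_map (axial_map x z) (axial_map x z) B) (vec4 1 0 0 (-1)) (vec4 1 0 0 (-1))"
    unfolding psd_iff_sesq by blast
  then have "x\<^sup>2 \<le> (1 + z\<^sup>2) / 2"
    unfolding sesq_pair sum_2 tensor_map_axial_nth
    by (simp add: B_def vec4_def less_eq_complex_def field_simps power2_eq_square)
  then show "x \<le> sqrt ((1 + z\<^sup>2) / 2)"
    by (rule real_le_rsqrt)
next
  define y where "y = sqrt ((1 + z\<^sup>2) / 2)"
  assume "x \<le> sqrt ((1 + z\<^sup>2) / 2)"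
  then have "x \<le> y"
    by (simp add: y_def)
  have y: "0 < y" "y\<^sup>2 = (1 + z\<^sup>2) / 2"
    by (simp_all add: y_def add_pos_nonneg)
  \<comment> \<open>Dephasing by \<open>x / y\<close> comes first, and the boundary map
    follows.\<close>
  have "axial_map x z = axial_map y z \<circ> axial_map (x / y) 1"
    using y(1) by (simp add: axial_map_comp)
  then have "tensor_map (axial_map x z) (axial_map x z) =
      tensor_map (axial_map y z) (axial_map y z)
        \<circ> tensor_map (axial_map (x / y) 1) (axial_map (x / y) 1)"
    by (simp add: tensor_map_comp clinear_axial_map)
  moreover have "\<bar>x / y\<bar> \<le> 1"
    using assms(1) y(1) \<open>x \<le> y\<close> by simp
  ultimately show "positive_map (tensor_map (axial_map x z) (axial_map x z))"
    using y assms(2)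
    by (simp add: positive_map_comp positive_map_def[of "tensor_map _ _"] clinear_tensor_map
        psd_tensor_axial_map_circle psd_tensor_dephasing)
qed

section \<open>Reduction of the dynamics to a scalar recursion\<close>

fun amplitude :: "real \<Rightarrow> real \<Rightarrow> nat \<Rightarrow> real" where
  "amplitude \<alpha> \<beta> 0 = 1"
| "amplitude \<alpha> \<beta> (Suc 0) = \<alpha>"
| "amplitude \<alpha> \<beta> (Suc (Suc n)) = \<alpha> * amplitude \<alpha> \<beta> (Suc n) + \<beta> * amplitude \<alpha> \<beta> n"

lemma amplitude_pos:
  assumes "0 < \<alpha>" "0 \<le> \<beta>"
  shows "0 < amplitude \<alpha> \<beta> n"
  using assms by (induction \<alpha> \<beta> n rule: amplitude.induct) (auto intro: add_pos_nonneg)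

text \<open>Dropping the second term of the recursion bounds each amplitude by its successor divided
  by \<alpha>. The bound is attained at \<open>n = 1\<close>.\<close>

lemma amplitude_step_le:
  assumes "0 < \<alpha>" "0 \<le> \<beta>"
  shows "amplitude \<alpha> \<beta> (Suc n) / amplitude \<alpha> \<beta> n \<le> \<alpha> + \<beta> / \<alpha>"
proof (cases n)
  case 0
  then show ?thesis using assms by simp
next
  case (Suc m)
  have "\<alpha> * amplitude \<alpha> \<beta> m \<le> amplitude \<alpha> \<beta> (Suc m)"
    using assms amplitude_pos[OF assms] by (cases m) (simp_all add: less_imp_le)
  from mult_left_mono[OF this, of "\<beta> / \<alpha>"]
  have "\<beta> * amplitude \<alpha> \<beta> m \<le> \<beta> / \<alpha> * amplitude \<alpha> \<beta> (Suc m)"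
    using assms by simp
  then show ?thesis
    using amplitude_pos[OF assms, of "Suc m"] Suc by (simp add: field_simps)
qed

section \<open>Pauli conjugations and sums over paths\<close>

lemma pauli_map_0 [simp]: "pauli_map 0 X = X"
  by (simp add: pauli_map_def pauli_def)

lemma pauli_map_1: "pauli_map (Suc 0) X = vector [vector [X$2$2, X$2$1], vector [X$1$2, X$1$1]]"
  by (simp add: pauli_map_def pauli_def vec_eq_iff forall_2 matrix_matrix_mult_def sum_2)

lemma pauli_map_2: "pauli_map 2 X = vector [vector [X$2$2, - X$2$1], vector [- X$1$2, X$1$1]]"
  by (simp add: pauli_map_def pauli_def vec_eq_iff forall_2 matrix_matrix_mult_def sum_2 algebra_simps)

lemma pauli_map_3: "pauli_map 3 X = vector [vector [X$1$1, - X$1$2], vector [- X$2$1, X$2$2]]"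
  by (simp add: pauli_map_def pauli_def vec_eq_iff forall_2 matrix_matrix_mult_def sum_2)

lemma pauli_map_scaleR_sum:
  "pauli_map k (\<Sum>i\<in>I. c i *\<^sub>R Y i) = (\<Sum>i\<in>I. c i *\<^sub>R pauli_map k (Y i))"
proof -
  have "linear (pauli_map k)"
    unfolding pauli_map_def
    by (rule linearI) (simp_all add: vec_eq_iff matrix_matrix_mult_def sum_2 algebra_simps)
  then show ?thesis
    by (simp add: linear_sum linear_scale)
qed

definition paths :: "nat \<Rightarrow> nat list set" where
  "paths n = {is. length is = n \<and> set is \<subseteq> {0..3}}"

lemma sum_atMost_3: "(\<Sum>k\<in>{0..3::nat}. h k) = h 0 + h (Suc 0) + h 2 + h 3"
  by (simp add: numeral_3_eq_3 numeral_2_eq_2 add.assoc)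

text \<open>Paths are split at the last index, whose Pauli map acts outermost.\<close>

lemma sum_paths_Suc: "(\<Sum>is\<in>paths (Suc n). h is) = (\<Sum>k\<in>{0..3}. \<Sum>is\<in>paths n. h (is @ [k]))"
proof -
  have "paths (Suc n) = (\<lambda>(k, is). is @ [k]) ` ({0..3} \<times> paths n)"
  proof safe
    fix js assume js: "js \<in> paths (Suc n)"
    then obtain k "is" where "js = is @ [k]"
      by (cases js rule: rev_cases) (auto simp: paths_def)
    with js show "js \<in> (\<lambda>(k, is). is @ [k]) ` ({0..3} \<times> paths n)"
      by (force simp: paths_def)
  qed (auto simp: paths_def)
  moreover have "inj_on (\<lambda>(k, is). is @ [k]) ({0..3} \<times> paths n)"
    by (auto simp: inj_on_def)
  ultimately show ?thesis
    by (simp add: sum.reindex sum.cartesian_product case_prod_unfold)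
qed

text \<open>The Markov property; the last visited index \<open>j\<close> is kept explicit because
  the next transition depends on it.\<close>

lemma path_prob_snoc:
  "path_prob p0 p \<Delta> r (is @ [j, k]) = trans_mat p0 p \<Delta> r k j * path_prob p0 p \<Delta> r (is @ [j])"
proof -
  have "(\<Prod>i = 1..<Suc (length is). trans_mat p0 p \<Delta> r ((is @ [j, k]) ! i) ((is @ [j, k]) ! (i - 1)))
      = (\<Prod>i = 1..<Suc (length is). trans_mat p0 p \<Delta> r ((is @ [j]) ! i) ((is @ [j]) ! (i - 1)))"
    by (rule prod.cong) (auto simp: nth_append)
  moreover have "(is @ [j, k]) ! 0 = (is @ [j]) ! 0"
    by (simp add: nth_append)
  ultimately show ?thesis
    by (simp add: path_prob_def prod.atLeastLessThan_Suc nth_append)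
qed

text \<open>The contribution of the paths ending in \<open>k\<close>, before the last Pauli map \<open>\<phi>\<^sub>k\<close> is applied.\<close>

definition pre_dynamics :: "real \<Rightarrow> real \<Rightarrow> real \<Rightarrow> real \<Rightarrow> nat \<Rightarrow> nat \<Rightarrow> complex^2^2 \<Rightarrow> complex^2^2" where
  "pre_dynamics p0 p \<Delta> r n k X =
     (\<Sum>is\<in>paths n. path_prob p0 p \<Delta> r (is @ [k]) *\<^sub>R fold pauli_map is X)"

lemma pre_dynamics_0: "pre_dynamics p0 p \<Delta> r 0 k X = inv_prob p0 p r k *\<^sub>R X"
proof -
  have "paths 0 = {[]}" by (auto simp: paths_def)
  then show ?thesis by (simp add: pre_dynamics_def path_prob_def)
qed

lemma pre_dynamics_Suc:
  "pre_dynamics p0 p \<Delta> r (Suc n) k X =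
     (\<Sum>j\<in>{0..3}. trans_mat p0 p \<Delta> r k j *\<^sub>R pauli_map j (pre_dynamics p0 p \<Delta> r n j X))"
  by (simp add: pre_dynamics_def sum_paths_Suc pauli_map_scaleR_sum path_prob_snoc scaleR_sum_right)

lemma qubit_dynamics_Suc:
  "qubit_dynamics p0 p \<Delta> r (Suc n) X = (\<Sum>k\<in>{0..3}. pauli_map k (pre_dynamics p0 p \<Delta> r n k X))"
  by (simp add: pre_dynamics_def qubit_dynamics_def pauli_map_scaleR_sum sum_paths_Suc flip: paths_def)

text \<open>Half the difference of conjugation by sigma_1 and by sigma_2.\<close>

definition flip_off_diagonal :: "complex^2^2 \<Rightarrow> complex^2^2" where
  "flip_off_diagonal X = vector [vector [0, X$2$1], vector [X$1$2, 0]]"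

text \<open>The shape that \<open>pre_dynamics\<close> keeps for all \<open>n\<close>: the invariant
  vector times an axial map, plus a memory term of size \<open>e\<close> along (0, 1, -1,
  0).\<close>

definition step_state :: "real \<Rightarrow> real \<Rightarrow> real \<Rightarrow> real \<Rightarrow> real \<Rightarrow> real \<Rightarrow> complex^2^2 \<Rightarrow> nat \<Rightarrow> complex^2^2" where
  "step_state p0 p r x z e X k =
     inv_prob p0 p r k *\<^sub>R axial_map x z X + ([0, 1, -1, 0] ! k * e) *\<^sub>R flip_off_diagonal X"

text \<open>In the axial part sigma_1 and sigma_2 have equal weights and cancel on coherences,
  leaving \<open>p0 - r\<close>. In the memory term their signs are opposite, so they add up to
  \<open>2 * e\<close>.\<close>

lemma sum_pauli_map_step_state:
  assumes "p0 + 2 * p + r = 1"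
  shows "(\<Sum>k\<in>{0..3}. pauli_map k (step_state p0 p r x z e X k))
    = axial_map ((1 - 2 * (p + r)) * x + 2 * e) ((1 - 4 * p) * z) X"
proof -
  have p0: "p0 = 1 - 2 * p - r" using assms by simp
  show ?thesis
    by (simp add: sum_atMost_3 step_state_def inv_prob_def flip_off_diagonal_def
        pauli_map_1 pauli_map_2 pauli_map_3 vec_eq_iff forall_2 p0)
      (simp add: scaleR_conv_of_real[where 'a=complex] field_simps)
qed

text \<open>The memory term cancels here, so the recursion reaches back only two steps.\<close>

lemma diff_pauli_map_step_state:
  "pauli_map 1 (step_state p0 p r x z e X 1) - pauli_map 2 (step_state p0 p r x z e X 2)
    = (2 * p * x) *\<^sub>R flip_off_diagonal X"
  by (simp add: step_state_def inv_prob_def flip_off_diagonal_def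
      pauli_map_1 pauli_map_2 vec_eq_iff forall_2 scaleR_conv_of_real[where 'a=complex] field_simps)

lemma sum_trans_mat:
  fixes Y :: "nat \<Rightarrow> complex^2^2"
  assumes "k \<le> 3"
  shows "(\<Sum>j\<in>{0..3}. trans_mat p0 p \<Delta> r k j *\<^sub>R Y j)
    = inv_prob p0 p r k *\<^sub>R (\<Sum>j\<in>{0..3}. Y j) + ([0, 1, -1, 0] ! k * \<Delta>) *\<^sub>R (Y 1 - Y 2)"
proof -
  have "k = 0 \<or> k = 1 \<or> k = 2 \<or> k = 3" using assms by auto
  then show ?thesis
    by (elim disjE) (simp_all add: sum_atMost_3 trans_mat_def inv_prob_def algebra_simps)
qed

text \<open>Memory starts at 0, as the first index is drawn from the invariant vector alone; later
  it comes from the rank-one correction of the transition matrix.\<close>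

lemma pre_dynamics_eq:
  fixes p0 p \<Delta> r :: real
  defines "A \<equiv> amplitude (1 - 2 * (p + r)) (4 * p * \<Delta>)"
  assumes sum_1: "p0 + 2 * p + r = 1" and "k \<le> 3"
  shows "pre_dynamics p0 p \<Delta> r n k X = step_state p0 p r (A n) ((1 - 4 * p) ^ n)
    (case n of 0 \<Rightarrow> 0 | Suc m \<Rightarrow> 2 * p * \<Delta> * A m) X k"
  using \<open>k \<le> 3\<close>
proof (induction n arbitrary: k)
  case 0
  then show ?case
    by (simp add: pre_dynamics_0 step_state_def A_def)
next
  case (Suc n)
  define e where "e = (case n of 0 \<Rightarrow> 0 | Suc m \<Rightarrow> 2 * p * \<Delta> * A m)"
  define V where "V = step_state p0 p r (A n) ((1 - 4 * p) ^ n) e X"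
  have A: "(1 - 2 * (p + r)) * A n + 2 * e = A (Suc n)"
    by (cases n) (simp_all add: A_def e_def)
  have "pre_dynamics p0 p \<Delta> r (Suc n) k X = (\<Sum>j\<in>{0..3}. trans_mat p0 p \<Delta> r k j *\<^sub>R pauli_map j (V j))"
    unfolding pre_dynamics_Suc by (rule sum.cong) (simp_all add: Suc.IH V_def e_def)
  also have "\<dots> = inv_prob p0 p r k *\<^sub>R axial_map (A (Suc n)) ((1 - 4 * p) ^ Suc n) X
      + ([0, 1, -1, 0] ! k * \<Delta>) *\<^sub>R (2 * p * A n) *\<^sub>R flip_off_diagonal X"
    unfolding sum_trans_mat[OF Suc.prems] V_def sum_pauli_map_step_state[OF sum_1]
      diff_pauli_map_step_state A by simp
  also have "\<dots> = step_state p0 p r (A (Suc n)) ((1 - 4 * p) ^ Suc n) (2 * p * \<Delta> * A n) X k"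
    by (simp add: step_state_def mult_ac)
  finally show ?case
    by simp
qed

lemma qubit_dynamics_eq:
  assumes sum_1: "p0 + 2 * p + r = 1"
  shows "qubit_dynamics p0 p \<Delta> r n =
    axial_map (amplitude (1 - 2 * (p + r)) (4 * p * \<Delta>) n) ((1 - 4 * p) ^ n)"
proof
  fix X
  show "qubit_dynamics p0 p \<Delta> r n X =
    axial_map (amplitude (1 - 2 * (p + r)) (4 * p * \<Delta>) n) ((1 - 4 * p) ^ n) X"
  proof (cases n)
    case 0
    then show ?thesis by (simp add: qubit_dynamics_def)
  next
    case (Suc m)
    define A e where "A = amplitude (1 - 2 * (p + r)) (4 * p * \<Delta>)"
      and "e = (case m of 0 \<Rightarrow> 0 | Suc l \<Rightarrow> 2 * p * \<Delta> * A l)"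
    have "qubit_dynamics p0 p \<Delta> r n X =
        (\<Sum>k\<in>{0..3}. pauli_map k (step_state p0 p r (A m) ((1 - 4 * p) ^ m) e X k))"
      unfolding Suc qubit_dynamics_Suc
      by (rule sum.cong) (simp_all only: atLeastAtMost_iff pre_dynamics_eq[OF sum_1] A_def e_def)
    also have "\<dots> = axial_map (A n) ((1 - 4 * p) ^ n) X"
      unfolding sum_pauli_map_step_state[OF sum_1]
      by (cases m) (simp_all add: Suc A_def e_def mult.assoc)
    finally show ?thesis
      by (simp add: A_def)
  qed
qed

section \<open>From one-step rates to divisibility\<close>

lemma intertwiner_axial_map:
  assumes "\<And>n. L n = axial_map (A n) (z ^ n)" "\<And>n. A n \<noteq> 0" "z \<noteq> 0" "m \<le> n"
  shows "intertwiner L n m = axial_map (A n / A m) (z ^ (n - m))"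
  using assms by (simp add: intertwiner_def inv_axial_map axial_map_comp power_diff)

text \<open>\<open>P\<close> stands for any of the three properties. Since it is closed under
  composition, only one-step intertwiners matter, and these all share the same
  \<open>z\<close>.\<close>

lemma all_intertwiners_iff:
  fixes P :: "(complex^2^2 \<Rightarrow> complex^2^2) \<Rightarrow> bool"
  assumes L: "\<And>n. L n = axial_map (amplitude \<alpha> \<beta> n) (z ^ n)"
    and pos: "0 < \<alpha>" "0 \<le> \<beta>" and "z \<noteq> 0"
    and P_iff: "\<And>x. 0 \<le> x \<Longrightarrow> P (axial_map x z) \<longleftrightarrow> x \<le> c"
    and P_id: "P id"
    and P_comp: "\<And>x z x' z'. P (axial_map x z) \<Longrightarrow> P (axial_map x' z') \<Longrightarrow>
      P (axial_map x z \<circ> axial_map x' z')"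
  shows "(\<forall>n m. m \<le> n \<longrightarrow> P (intertwiner L n m)) \<longleftrightarrow> \<alpha> + \<beta> / \<alpha> \<le> c"
proof
  note A_pos = amplitude_pos[OF pos]
  have nz: "amplitude \<alpha> \<beta> n \<noteq> 0" for n
    using A_pos[of n] by simp
  note inter = intertwiner_axial_map[OF L nz \<open>z \<noteq> 0\<close>]
  {
    assume "\<forall>n m. m \<le> n \<longrightarrow> P (intertwiner L n m)"
    \<comment> \<open>The step from 1 to 2 has the largest rate, so it alone forces the
      inequality.\<close>
    then have "P (intertwiner L 2 1)"
      by simp
    also have "intertwiner L 2 1 = axial_map (\<alpha> + \<beta> / \<alpha>) z"
      using pos by (simp add: inter numeral_2_eq_2 field_simps)
    finally show "\<alpha> + \<beta> / \<alpha> \<le> c"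
      using P_iff pos by simp
  next
    assume c: "\<alpha> + \<beta> / \<alpha> \<le> c"
    have step: "P (axial_map (amplitude \<alpha> \<beta> (Suc n) / amplitude \<alpha> \<beta> n) z)" for n
      using P_iff amplitude_step_le[OF pos, of n] c A_pos[of n] A_pos[of "Suc n"] by simp
    have "P (axial_map (amplitude \<alpha> \<beta> (m + k) / amplitude \<alpha> \<beta> m) (z ^ k))" for m k
    proof (induction k)
      case 0
      have "axial_map (amplitude \<alpha> \<beta> (m + 0) / amplitude \<alpha> \<beta> m) (z ^ 0) = id"
        using nz by simp
      with P_id show ?case by (simp only:)
    next
      case (Suc k)
      show ?case
        using P_comp[OF step[of "m + k"] Suc.IH] nz by (simp add: axial_map_comp)
    qed
    note steps = this
    show "\<forall>n m. m \<le> n \<longrightarrow> P (intertwiner L n m)"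
    proof (intro allI impI)
      fix n m :: nat
      assume "m \<le> n"
      with steps[of m "n - m"] show "P (intertwiner L n m)"
        by (simp add: inter)
    qed
  }
qed

theorem proposition3:
  fixes p0 p \<Delta> r \<alpha> :: real and \<Lambda> :: "nat \<Rightarrow> complex^2^2 \<Rightarrow> complex^2^2"
  assumes "0 \<le> p0" and "0 \<le> r"
    and "0 \<le> \<Delta>" and "\<Delta> \<le> p" and "p \<le> 1 / 2"
    and "p0 + 2 * p + r = 1"
    and "\<alpha> = 1 - 2 * (p + r)" and "\<alpha> > 0"
    and "p \<noteq> 1 / 4"
    and "\<Lambda> = qubit_dynamics p0 p \<Delta> r"
  shows "(P_divisible \<Lambda> \<longleftrightarrow> 2 * p * \<Delta> \<le> r * \<alpha> + p * \<alpha>) \<and>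
         (CP_divisible \<Lambda> \<longleftrightarrow> 2 * p * \<Delta> \<le> r * \<alpha>) \<and>
         (tensor_P_divisible \<Lambda> \<longleftrightarrow>
            2 * p * \<Delta> \<le> \<alpha> * (r + p) - \<alpha> / 2 * (1 - sqrt (1 - 4 * p * (1 - 2 * p))))"
proof -
  define \<beta> z where "\<beta> = 4 * p * \<Delta>" and "z = 1 - 4 * p"
  have L: "\<Lambda> n = axial_map (amplitude \<alpha> \<beta> n) (z ^ n)" for n
    using qubit_dynamics_eq assms by (simp add: \<beta>_def z_def)
  have \<beta>: "0 \<le> \<beta>" and z: "z \<noteq> 0" "\<bar>z\<bar> \<le> 1"
    using assms by (auto simp: \<beta>_def z_def)
  note crit = all_intertwiners_iff[OF L \<open>\<alpha> > 0\<close> \<beta> z(1)]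
  \<comment> \<open>One form for all three thresholds: \<open>c\<close> will be 1,
    \<open>1 - 2 * p\<close> and the square root.\<close>
  have rate: "\<alpha> + \<beta> / \<alpha> \<le> c \<longleftrightarrow> 2 * p * \<Delta> \<le> \<alpha> * (r + p) - \<alpha> / 2 * (1 - c)" for c
  proof -
    have "\<alpha> + \<beta> / \<alpha> \<le> c \<longleftrightarrow> 2 * p * \<Delta> \<le> \<alpha> / 2 * (c - \<alpha>)"
      using \<open>\<alpha> > 0\<close> by (simp add: \<beta>_def field_simps)
    also have "c - \<alpha> = 2 * (r + p) - (1 - c)"
      using assms(7) by simp
    also have "\<alpha> / 2 * \<dots> = \<alpha> * (r + p) - \<alpha> / 2 * (1 - c)"
      by (simp add: field_simps)
    finally show ?thesis .
  qed
  \<comment> \<open>The identity is the axial map with both parameters 1, so the criteria apply to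
    it.\<close>
  have pos_id: "positive_map (id :: complex^2^2 \<Rightarrow> _)"
    and cp_id: "completely_positive_map (id :: complex^2^2 \<Rightarrow> _)"
    and tensor_id: "positive_map (tensor_map id id :: _ \<Rightarrow> complex^(2\<times>2)^(2\<times>2))"
    using positive_axial_map_iff[of 1 1] completely_positive_axial_map_iff[of 1 1]
      positive_tensor_axial_map_iff[of 1 1] by simp_all
  have tp_id: "trace_preserving (id :: complex^2^2 \<Rightarrow> _)"
    "trace_preserving (tensor_map id id :: _ \<Rightarrow> complex^(2\<times>2)^(2\<times>2))"
    using trace_preserving_axial_map[of 1 1] trace_preserving_tensor_axial_map[of 1 1] by simp_all
  have "P_divisible \<Lambda> \<longleftrightarrow> \<alpha> + \<beta> / \<alpha> \<le> 1"
    unfolding P_divisible_def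
    by (rule crit[where P = "\<lambda>F. positive_map F \<and> trace_preserving F"])
      (use z(2) in \<open>simp_all add: positive_axial_map_iff pos_id tp_id positive_map_comp
        trace_preserving_axial_map trace_preserving_comp\<close>)
  moreover have "CP_divisible \<Lambda> \<longleftrightarrow> \<alpha> + \<beta> / \<alpha> \<le> (1 + z) / 2"
    unfolding CP_divisible_def
    by (rule crit[where P = "\<lambda>F. completely_positive_map F \<and> trace_preserving F"])
      (use z(2) in \<open>simp_all add: completely_positive_axial_map_iff cp_id tp_id
        completely_positive_map_comp
        trace_preserving_axial_map trace_preserving_comp\<close>)
  moreover have "tensor_P_divisible \<Lambda> \<longleftrightarrow> \<alpha> + \<beta> / \<alpha> \<le> sqrt ((1 + z\<^sup>2) / 2)"
    unfolding tensor_P_divisible_def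
    by (rule crit[where P = "\<lambda>F. positive_map (tensor_map F F) \<and> trace_preserving (tensor_map F F)"])
      (use z(2) in \<open>simp_all add: positive_tensor_axial_map_iff tensor_id tp_id
        positive_map_comp tensor_map_comp clinear_axial_map trace_preserving_comp
        trace_preserving_tensor_axial_map\<close>)
  moreover have "(1 + z) / 2 = 1 - 2 * p" and "(1 + z\<^sup>2) / 2 = 1 - 4 * p * (1 - 2 * p)"
    by (simp_all add: z_def power2_eq_square field_simps)
  moreover have "\<alpha> * (r + p) - \<alpha> / 2 * (1 - 1) = r * \<alpha> + p * \<alpha>"
    "\<alpha> * (r + p) - \<alpha> / 2 * (1 - (1 - 2 * p)) = r * \<alpha>"
    by (simp_all add: algebra_simps)
  ultimately show ?thesis
    by (simp only: rate)
qed

end
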